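(* Let $p\ge1$ and let $(a_n)_{n\ge0}$ be uniformly bounded positive real numbers. For every $k\in[0:p]$ and every $n\ge k$, $$B_{k,n}(x)=(-1)^{n(k+1)-\binom{k+1}{2}}\,c_k\,P_{k,n}(x),$$ where $$c_k=(-1)^k\left(\int d\nu_1(t)\right)\left(\int Q_1(t)\,d\nu_2(t)\right)\cdots\left(\int Q_{k-1}(t)\,d\nu_k(t)\right)$$ (with $\binom12=0$ and $c_0=1$).
   Context: Notation: $[i:j]=\{i,i+1,\dots,j\}$; $S_+=\{x\in\mathbb C: x^{p+1}\in\mathbb R_+\}$. Polynomials: $Q_n$ are the monic polynomials with $xQ_n(x)=Q_{n+1}(x)+a_{n-p}Q_{n-p}(x)$, $n\ge0$, $Q_0\equiv1$, $Q_{-1}\equiv\dots\equiv Q_{-p}\equiv0$. Orthogonality measures: for $l\in[0:p]$ let $Q_{n,l}$ be the monic polynomials of degree $n-l$ given by $xQ_{n,l}=Q_{n+1,l}+a_{n-p}Q_{n-p,l}$, $n\ge l$, $Q_{l,l}\equiv1$, $Q_{l-1,l}\equiv\dots\equiv Q_{l-p,l}\equiv0$. It is known (Aptekarev-Kalyagin-Van Iseghem) that there are an increasing sequence of positive integers $(n_j)$ and compactly supported measures $\nu_1,\dots,\nu_p$ on $S_+$ with $\lim_{j\to\infty}Q_{(p+1)n_j,l}(x)/Q_{(p+1)n_j}(x)=\int\frac{d\nu_l(t)}{x-t}$ uniformly on compact subsets of $\mathbb C\setminus S_+$, $l\in[1:p]$; the moments of $\nu_l$ do not depend on the choice of $(n_j)$,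 and $\int Q_n(x)x^m\,d\nu_j(x)=0$ for $m\in[0:\lfloor\frac{n-j}{p}\rfloor]$, $j\in[1:p]$. The second kind functions are $\Psi_n^{(j)}(z)=\int\frac{Q_n(t)}{z-t}\,d\nu_j(t)$. Principal Riemann-Hilbert minors: for $n\ge k$, $$B_{k,n}(z)=\det\begin{pmatrix}Q_n(z)&\Psi_n^{(1)}(z)&\cdots&\Psi_n^{(k)}(z)\\ \vdots&\vdots&&\vdots\\ Q_{n-k}(z)&\Psi_{n-k}^{(1)}(z)&\cdots&\Psi_{n-k}^{(k)}(z)\end{pmatrix}.$$ Generalized eigenvalue determinants: $H_n=(H_{i,j})_{i,j=0}^{n-1}$ is the $n\times n$ matrix with $H_{j-1,j}=1$, $H_{j+p,j}=a_j$ and all other entries $0$. For $n>k$, $P_{k,n}(x)$ is the determinant of the submatrix of $H_n-xI_n$ obtained by skipping the first $k$ rows and the last $k$ columns; $P_{k,n}\equiv1$ for $n\le k$. *)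

theory Defs
  imports
    "HOL-Analysis.Bochner_Integration"
    "HOL-Analysis.Complex_Analysis_Basics"
    "Jordan_Normal_Form.Determinant"
    "Jordan_Normal_Form.DL_Submatrix"
begin

definition S_plus :: "nat \<Rightarrow> complex set" where
  "S_plus p = {x. x ^ (p + 1) \<in> \<real>\<^sub>\<ge>\<^sub>0}"

(* Q_{n,l}, for all n >= 0. The recurrence x Q_{n,l} = Q_{n+1,l} + a_{n-p} Q_{n-p,l} is solved
   for Q_{n+1,l}. The polynomials with index n < l vanish, and for n < p the last term is absent,
   since it involves a polynomial Q_{n-p,l} of negative index. *)
fun Q_assoc :: "(nat \<Rightarrow> real) \<Rightarrow> nat \<Rightarrow> nat \<Rightarrow> nat \<Rightarrow> complex poly" where
  "Q_assoc a p l 0 = (if l = 0 then 1 else 0)"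
| "Q_assoc a p l (Suc n) =
     (if Suc n < l then 0
      else if Suc n = l then 1
      else [:0, 1:] * Q_assoc a p l n
             - (if p \<le> n then smult (of_real (a (n - p))) (Q_assoc a p l (n - p)) else 0))"

(* For l = 0 the recurrence and the initial values of Q_{n,l} are those of Q_n. *)
definition Q_poly :: "(nat \<Rightarrow> real) \<Rightarrow> nat \<Rightarrow> nat \<Rightarrow> complex poly" where
  "Q_poly a p n = Q_assoc a p 0 n"

(* The orthogonality measures are complex measures: for p >= 2 the mass of nu_2 is 0 while
   nu_2 itself is not, so they cannot all be positive. A complex Borel measure nu on the plane is
   given here by its polar decomposition d(nu) = h d(mu), where mu is the total variation
   of nu, a finite positive Borel measure, and |h| = 1. *)
type_synonym complex_measure = "complex measure \<times> (complex \<Rightarrow> complex)"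

definition is_complex_measure :: "complex_measure \<Rightarrow> bool" where
  "is_complex_measure \<nu> \<longleftrightarrow>
     finite_measure (fst \<nu>) \<and> sets (fst \<nu>) = sets borel \<and>
     snd \<nu> \<in> borel_measurable borel \<and> (\<forall>t. cmod (snd \<nu> t) = 1)"

definition cm_integral :: "complex_measure \<Rightarrow> (complex \<Rightarrow> complex) \<Rightarrow> complex" where
  "cm_integral \<nu> f = (\<integral>t. f t * snd \<nu> t \<partial>(fst \<nu>))"

definition cm_support :: "complex_measure \<Rightarrow> complex set" where
  "cm_support \<nu> = {t. \<forall>U. open U \<and> t \<in> U \<longrightarrow> emeasure (fst \<nu>) U > 0}"

definition second_kind ::
  "(nat \<Rightarrow> real) \<Rightarrow> nat \<Rightarrow> complex_measure \<Rightarrow> nat \<Rightarrow> complex \<Rightarrow> complex" where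
  "second_kind a p \<nu> n z = cm_integral \<nu> (\<lambda>t. poly (Q_poly a p n) t / (z - t))"

(* Meaningful for k <= n only, because of the truncated subtraction n - i. *)
definition RH_minor ::
  "(nat \<Rightarrow> real) \<Rightarrow> nat \<Rightarrow> (nat \<Rightarrow> complex_measure) \<Rightarrow> nat \<Rightarrow> nat \<Rightarrow> complex \<Rightarrow> complex" where
  "RH_minor a p \<nu> k n z =
     det (mat (k + 1) (k + 1) (\<lambda>(i, j).
       if j = 0 then poly (Q_poly a p (n - i)) z else second_kind a p (\<nu> j) (n - i) z))"

definition H_mat :: "(nat \<Rightarrow> real) \<Rightarrow> nat \<Rightarrow> nat \<Rightarrow> complex mat" where
  "H_mat a p n = mat n n (\<lambda>(i, j).
     if j = i + 1 then 1 else if i = j + p then of_real (a j) else 0)"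

definition P_eig :: "(nat \<Rightarrow> real) \<Rightarrow> nat \<Rightarrow> nat \<Rightarrow> nat \<Rightarrow> complex \<Rightarrow> complex" where
  "P_eig a p k n x =
     (if n \<le> k then 1
      else det (submatrix (H_mat a p n - x \<cdot>\<^sub>m 1\<^sub>m n) {k..<n} {..<n - k}))"

definition c_const :: "(nat \<Rightarrow> real) \<Rightarrow> nat \<Rightarrow> (nat \<Rightarrow> complex_measure) \<Rightarrow> nat \<Rightarrow> complex" where
  "c_const a p \<nu> k =
     (-1) ^ k * (\<Prod>j\<in>{1..k}. cm_integral (\<nu> j) (\<lambda>t. poly (Q_poly a p (j - 1)) t))"

end

theory Submission
  imports Defs
begin

text \<open>
  Both \<open>Q\<^sub>n\<close> and the second kind functions solve the recurrence \<open>x u\<^sub>n = u\<^sub>n\<^sub>+\<^sub>1 + a\<^sub>n\<^sub>-\<^sub>p u\<^sub>n\<^sub>-\<^sub>p\<close>, the latter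
  with the inhomogeneous term \<open>\<integral> Q\<^sub>n d\<nu>\<^sub>j\<close>, which vanishes for \<open>n \<ge> j\<close>. Writing the recurrences for
  indices below \<open>n\<close> as the action of one unitriangular matrix therefore turns the Riemann-Hilbert minor into
  the complementary minor of \<open>H - x\<close>, times a triangular determinant whose diagonal gives \<open>c\<^sub>k\<close>.

  The orthogonality \<open>\<integral> Q\<^sub>n d\<nu>\<^sub>l = 0\<close> comes from the convergence of \<open>Q\<^sub>N\<^sub>,\<^sub>l / Q\<^sub>N\<close>: the remainder
  \<open>Q\<^sub>n Q\<^sub>N\<^sub>,\<^sub>l / Q\<^sub>N - Q\<^sub>n\<^sub>,\<^sub>l\<close> solves the recurrence up to a unit source at \<open>n = l - 1\<close> and vanishes at
  \<open>n = N\<close>, so by a maximum argument it is \<open>O(1/|z|)\<close> uniformly in \<open>N\<close> and \<open>n < N\<close>.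
\<close>

section \<open>The recurrence and its source terms\<close>

text \<open>The guard \<open>p \<le> i\<close> encodes zero values at negative indices. Source terms
  appear as nonzero defects, so homogeneous and inhomogeneous solutions are treated alike.\<close>

definition recurrence_defect ::
  "(nat \<Rightarrow> real) \<Rightarrow> nat \<Rightarrow> complex \<Rightarrow> (nat \<Rightarrow> complex) \<Rightarrow> nat \<Rightarrow> complex" where
  "recurrence_defect a p z u i =
     z * u i - u (Suc i) - (if p \<le> i then of_real (a (i - p)) * u (i - p) else 0)"

lemma Q_assoc_eq_0: "n < l \<Longrightarrow> Q_assoc a p l n = 0"
  by (cases n) auto

text \<open>The zeros before index \<open>l\<close> do not generate the value 1 there, whence a
  source at \<open>l - 1\<close>; for \<open>l = 0\<close> there is none.\<close>

lemma recurrence_defect_Q_assoc: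
  "recurrence_defect a p z (\<lambda>i. poly (Q_assoc a p l i) z) i = (if Suc i = l then -1 else 0)"
  by (auto simp: recurrence_defect_def Q_assoc_eq_0)

lemma recurrence_defect_Q_poly:
  "recurrence_defect a p z (\<lambda>i. poly (Q_poly a p i) z) i = 0"
  by (simp add: Q_poly_def recurrence_defect_Q_assoc)

lemma recurrence_defect_linear:
  "recurrence_defect a p z (\<lambda>i. c * u i - d * v i) i
     = c * recurrence_defect a p z u i - d * recurrence_defect a p z v i"
  by (simp add: recurrence_defect_def algebra_simps)

text \<open>A discrete maximum principle: where |u| attains its maximum M below \<open>N\<close>,
  the recurrence gives |z| M \<le> d + (1 + A) M. The zero at \<open>N\<close> covers a maximum
  attained at \<open>N - 1\<close>.\<close>

lemma norm_le_if_defect_le: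
  assumes a: "\<And>m. \<bar>a m\<bar> \<le> A" and z: "1 + A < cmod z"
    and N: "u N = 0" and d: "\<And>i. i < N \<Longrightarrow> cmod (recurrence_defect a p z u i) \<le> d"
    and i: "i < N"
  shows "cmod (u i) \<le> d / (cmod z - 1 - A)"
proof -
  define M where "M = Max ((\<lambda>i. cmod (u i)) ` {..<N})"
  have le_M: "cmod (u j) \<le> M" if "j < N" for j
    unfolding M_def using that by (intro Max_ge) auto
  have M0: "0 \<le> M"
    using le_M[OF i] norm_ge_zero[of "u i"] by linarith
  have A0: "0 \<le> A"
    using a[of 0] by linarith
  have "M \<in> (\<lambda>i. cmod (u i)) ` {..<N}"
    unfolding M_def using i by (intro Max_in) auto
  then obtain j where j: "j < N" "cmod (u j) = M"
    by auto
  have 1: "cmod (u (Suc j)) \<le> M"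
    using le_M[of "Suc j"] j(1) N M0 by (cases "Suc j = N") auto
  have 2: "cmod (if p \<le> j then of_real (a (j - p)) * u (j - p) else 0) \<le> A * M"
    using le_M[of "j - p"] j(1) A0 M0 a[of "j - p"] by (auto simp: norm_mult intro!: mult_mono)
  have "z * u j = recurrence_defect a p z u j + u (Suc j)
      + (if p \<le> j then of_real (a (j - p)) * u (j - p) else 0)"
    by (simp add: recurrence_defect_def)
  then have "cmod z * M \<le> d + M + A * M"
    using d[OF j(1)] 1 2 j(2) norm_triangle_le norm_mult
    by (smt (verit) norm_triangle_ineq)
  then have "M * (cmod z - 1 - A) \<le> d"
    by (simp add: algebra_simps)
  then have "M \<le> d / (cmod z - 1 - A)"
    using z by (simp add: field_simps)
  with le_M[OF i] show ?thesis
    by linarith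
qed

text \<open>If Q_N vanished at z, the maximum principle with source bound 0 would force Q_0 =
  0.\<close>

lemma Q_poly_nonzero:
  assumes a: "\<And>m. \<bar>a m\<bar> \<le> A" and z: "1 + A < cmod z"
  shows "poly (Q_poly a p N) z \<noteq> 0"
proof
  assume 0: "poly (Q_poly a p N) z = 0"
  then have N: "0 < N"
    by (cases N) (auto simp: Q_poly_def)
  have "cmod (poly (Q_poly a p 0) z) \<le> 0 / (cmod z - 1 - A)"
    by (rule norm_le_if_defect_le[where u = "\<lambda>i. poly (Q_poly a p i) z" and p = p and a = a,
          OF a z 0 _ N])
       (simp add: recurrence_defect_Q_poly)
  then show False
    by (simp add: Q_poly_def)
qed

lemma Pade_remainder_bound:
  assumes a: "\<And>m. \<bar>a m\<bar> \<le> A" and z: "1 + A < cmod z" and n: "n < N"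
  shows "cmod (poly (Q_poly a p n) z * (poly (Q_assoc a p l N) z / poly (Q_poly a p N) z)
           - poly (Q_assoc a p l n) z) \<le> 1 / (cmod z - 1 - A)"
proof -
  define f where "f = poly (Q_assoc a p l N) z / poly (Q_poly a p N) z"
  \<comment> \<open>The factor 1 gives the difference the shape of
    \<open>recurrence_defect_linear\<close>.\<close>
  define u where "u i = f * poly (Q_poly a p i) z - 1 * poly (Q_assoc a p l i) z" for i
  have "u N = 0"
    using Q_poly_nonzero[where a = a, OF a z, of p N] by (simp add: u_def f_def)
  moreover have "cmod (recurrence_defect a p z u i) \<le> 1" for i
    unfolding u_def recurrence_defect_linear recurrence_defect_Q_poly recurrence_defect_Q_assoc
    by simp
  ultimately have "cmod (u n) \<le> 1 / (cmod z - 1 - A)"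
    by (intro norm_le_if_defect_le[OF a z _ _ n]) auto
  then show ?thesis
    by (simp add: u_def f_def mult.commute)
qed

section \<open>Complex measures and second kind functions\<close>

text \<open>The complement of the support is the union of all open null sets, and by Lindelof
  countably many of them suffice.\<close>

lemma AE_cm_support:
  assumes "is_complex_measure \<nu>"
  shows "AE t in fst \<nu>. t \<in> cm_support \<nu>"
proof -
  define F where "F = {U. open U \<and> emeasure (fst \<nu>) U = 0}"
  obtain F' where F': "F' \<subseteq> F" "countable F'" "\<Union>F' = \<Union>F"
    by (rule Lindelof[of F]) (auto simp: F_def)
  have "\<Union>F' \<in> null_sets (fst \<nu>)"
  proof -
    have "(\<Union>U\<in>F'. U) \<in> null_sets (fst \<nu>)"
      using F'(1) assms
      by (intro null_sets_UN'[OF F'(2)]) (auto simp: F_def null_sets_def is_complex_measure_def)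
    then show ?thesis
      by simp
  qed
  moreover have "- cm_support \<nu> = \<Union>F"
    by (auto simp: cm_support_def F_def not_less)
  ultimately show ?thesis
    using F'(3) by (intro AE_I'[of "\<Union>F'"]) auto
qed

lemma cm_integrable:
  assumes \<nu>: "is_complex_measure \<nu>" and f: "f \<in> borel_measurable borel"
    and B: "\<And>t. t \<in> cm_support \<nu> \<Longrightarrow> cmod (f t) \<le> B"
  shows "integrable (fst \<nu>) (\<lambda>t. f t * snd \<nu> t)"
proof -
  interpret finite_measure "fst \<nu>"
    using \<nu> by (simp add: is_complex_measure_def)
  have [measurable_cong]: "sets (fst \<nu>) = sets borel"
    and [measurable]: "snd \<nu> \<in> borel_measurable borel"
    using \<nu> by (auto simp: is_complex_measure_def)
  note [measurable] = f
  show ?thesis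
  proof (rule integrable_const_bound[of _ B])
    show "AE t in fst \<nu>. cmod (f t * snd \<nu> t) \<le> B"
      using AE_cm_support[OF \<nu>]
      by eventually_elim (use \<nu> B in \<open>auto simp: norm_mult is_complex_measure_def\<close>)
  qed measurable
qed

lemma cm_integral_bound:
  assumes \<nu>: "is_complex_measure \<nu>" and f: "f \<in> borel_measurable borel"
    and B: "\<And>t. t \<in> cm_support \<nu> \<Longrightarrow> cmod (f t) \<le> B"
  shows "cmod (cm_integral \<nu> f) \<le> B * measure (fst \<nu>) (space (fst \<nu>))"
proof -
  interpret finite_measure "fst \<nu>"
    using \<nu> by (simp add: is_complex_measure_def)
  have "cmod (cm_integral \<nu> f) \<le> (\<integral>t. cmod (f t * snd \<nu> t) \<partial>(fst \<nu>))"
    unfolding cm_integral_def by (rule integral_norm_bound)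
  also have "\<dots> \<le> (\<integral>t. B \<partial>(fst \<nu>))"
  proof (rule integral_mono_AE)
    show "AE t in fst \<nu>. cmod (f t * snd \<nu> t) \<le> B"
      using AE_cm_support[OF \<nu>]
      by eventually_elim (use \<nu> B in \<open>auto simp: norm_mult is_complex_measure_def\<close>)
  qed (use cm_integrable[OF \<nu> f B] in auto)
  finally show ?thesis
    by (simp add: mult.commute)
qed

lemma cm_integrable_Cauchy:
  assumes \<nu>: "is_complex_measure \<nu>" and K: "compact (cm_support \<nu>)" and x: "x \<notin> cm_support \<nu>"
  shows "integrable (fst \<nu>) (\<lambda>t. poly q t / (x - t) * snd \<nu> t)"
proof -
  have cont: "continuous_on (cm_support \<nu>) (\<lambda>t. poly q t / (x - t))"
    using x by (intro continuous_intros) auto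
  then obtain B where "\<forall>y\<in>(\<lambda>t. poly q t / (x - t)) ` cm_support \<nu>. cmod y \<le> B"
    using compact_imp_bounded[OF compact_continuous_image[OF cont K]] unfolding bounded_iff by blast
  then have B: "\<And>t. t \<in> cm_support \<nu> \<Longrightarrow> cmod (poly q t / (x - t)) \<le> B"
    by blast
  show ?thesis
    by (intro cm_integrable[OF \<nu> _ B] borel_measurable_divide borel_measurable_continuous_onI
        continuous_intros)
qed

text \<open>By the recurrence at t the combined numerator is (x - t) Q_n(t), whose first factor
  cancels the Cauchy kernel.\<close>

lemma recurrence_defect_second_kind:
  assumes \<nu>: "is_complex_measure \<nu>" and K: "compact (cm_support \<nu>)" and x: "x \<notin> cm_support \<nu>"
  shows "recurrence_defect a p x (\<lambda>i. second_kind a p \<nu> i x) n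
     = cm_integral \<nu> (poly (Q_poly a p n))"
proof -
  define F where "F i t = poly (Q_poly a p i) t / (x - t) * snd \<nu> t" for i t
  \<comment> \<open>As c = 0 for n < p, the truncated index \<open>n - p\<close> does no
    harm.\<close>
  define c where "c = (if p \<le> n then complex_of_real (a (n - p)) else 0)"
  have int: "integrable (fst \<nu>) (F i)" for i
    unfolding F_def by (rule cm_integrable_Cauchy[OF assms])
  have sk: "second_kind a p \<nu> i x = integral\<^sup>L (fst \<nu>) (F i)" for i
    unfolding second_kind_def cm_integral_def F_def ..
  have "recurrence_defect a p x (\<lambda>i. second_kind a p \<nu> i x) n
      = x * integral\<^sup>L (fst \<nu>) (F n) - integral\<^sup>L (fst \<nu>) (F (Suc n))
        - c * integral\<^sup>L (fst \<nu>) (F (n - p))"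
    by (simp add: recurrence_defect_def sk c_def)
  also have "\<dots> = (\<integral>t. x * F n t - F (Suc n) t - c * F (n - p) t \<partial>(fst \<nu>))"
    using int by simp
  also have "\<dots> = (\<integral>t. poly (Q_poly a p n) t * snd \<nu> t \<partial>(fst \<nu>))"
  proof (rule integral_cong_AE)
    have [measurable_cong]: "sets (fst \<nu>) = sets borel"
      and [measurable]: "snd \<nu> \<in> borel_measurable borel"
      using \<nu> by (auto simp: is_complex_measure_def)
    have [measurable]: "poly q \<in> borel_measurable borel" for q :: "complex poly"
      by (intro borel_measurable_continuous_onI continuous_intros)
    show "(\<lambda>t. x * F n t - F (Suc n) t - c * F (n - p) t) \<in> borel_measurable (fst \<nu>)"
      using int by (intro borel_measurable_integrable) auto
    show "(\<lambda>t. poly (Q_poly a p n) t * snd \<nu> t) \<in> borel_measurable (fst \<nu>)"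
      by measurable
    show "AE t in fst \<nu>. x * F n t - F (Suc n) t - c * F (n - p) t = poly (Q_poly a p n) t * snd \<nu> t"
      using AE_cm_support[OF \<nu>]
    proof eventually_elim
      fix t assume "t \<in> cm_support \<nu>"
      then have t: "x - t \<noteq> 0"
        using x by auto
      have "poly (Q_poly a p (Suc n)) t
          = t * poly (Q_poly a p n) t - c * poly (Q_poly a p (n - p)) t"
        by (simp add: Q_poly_def c_def)
      then have "x * F n t - F (Suc n) t - c * F (n - p) t
          = (x - t) * poly (Q_poly a p n) t / (x - t) * snd \<nu> t"
        by (simp add: F_def diff_divide_distrib left_diff_distrib right_diff_distrib)
      then show "x * F n t - F (Suc n) t - c * F (n - p) t = poly (Q_poly a p n) t * snd \<nu> t"
        using t by simp
    qed
  qed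
  finally show ?thesis
    by (simp add: cm_integral_def)
qed

text \<open>If a disc of radius rho around 0 contains the support, then |z - t| \<ge> |z| - rho on
  it. This yields the decay at infinity.\<close>

lemma second_kind_bound:
  assumes \<nu>: "is_complex_measure \<nu>" and K: "compact (cm_support \<nu>)"
  obtains C \<rho> where "\<And>z. \<rho> < cmod z \<Longrightarrow> cmod (second_kind a p \<nu> n z) \<le> C / (cmod z - \<rho>)"
proof -
  obtain \<rho> where \<rho>: "\<And>t. t \<in> cm_support \<nu> \<Longrightarrow> cmod t \<le> \<rho>"
    using compact_imp_bounded[OF K] by (auto simp: bounded_iff)
  have cont: "continuous_on (cm_support \<nu>) (poly (Q_poly a p n))"
    by (intro continuous_intros)
  then obtain B where "\<forall>y\<in>poly (Q_poly a p n) ` cm_support \<nu>. cmod y \<le> B"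
    using compact_imp_bounded[OF compact_continuous_image[OF cont K]] unfolding bounded_iff by blast
  then have B: "\<And>t. t \<in> cm_support \<nu> \<Longrightarrow> cmod (poly (Q_poly a p n) t) \<le> B"
    by blast
  have "cmod (second_kind a p \<nu> n z)
      \<le> B / (cmod z - \<rho>) * measure (fst \<nu>) (space (fst \<nu>))" if z: "\<rho> < cmod z" for z
    unfolding second_kind_def
  proof (rule cm_integral_bound[OF \<nu>])
    show "(\<lambda>t. poly (Q_poly a p n) t / (z - t)) \<in> borel_measurable borel"
      by (intro borel_measurable_divide borel_measurable_continuous_onI continuous_intros)
    fix t assume t: "t \<in> cm_support \<nu>"
    have "cmod z - \<rho> \<le> cmod (z - t)"
      using \<rho>[OF t] norm_triangle_ineq2[of z t] by linarith
    then show "cmod (poly (Q_poly a p n) t / (z - t)) \<le> B / (cmod z - \<rho>)"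
      unfolding norm_divide using B[OF t] z norm_ge_zero[of "poly (Q_poly a p n) t"]
      by (intro frac_le) linarith+
  qed
  then show thesis
    by (intro that[of \<rho> "B * measure (fst \<nu>) (space (fst \<nu>))"]) simp
qed

section \<open>Orthogonality relations\<close>

text \<open>Convergence is known only off the unbounded set \<open>S_plus p\<close>, so infinity is
  approached along a ray. Its direction is a (p+1)-th root of -1, which makes (p+1)-th powers
  negative.\<close>

lemma ray_off_S_plus:
  obtains \<omega> where "cmod \<omega> = 1" "\<And>r. 0 < r \<Longrightarrow> of_real r * \<omega> \<notin> S_plus p"
proof
  show "cmod (cis (pi / real (p + 1))) = 1"
    by simp
  fix r :: real assume "0 < r"
  have "cis (pi / real (p + 1)) ^ (p + 1) = cis pi"
    unfolding DeMoivre by simp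
  then have "(of_real r * cis (pi / real (p + 1))) ^ (p + 1) = of_real (- (r ^ (p + 1)))"
    unfolding power_mult_distrib by simp
  moreover have "0 < r ^ (p + 1)"
    using \<open>0 < r\<close> by simp
  ultimately show "of_real r * cis (pi / real (p + 1)) \<notin> S_plus p"
    unfolding S_plus_def mem_Collect_eq by (simp only: nonneg_Reals_of_real_iff)
qed

text \<open>
  The functions \<open>Q\<^sub>n f - Q\<^sub>n\<^sub>,\<^sub>l\<close>, with \<open>f\<close> the Cauchy transform of \<open>\<nu>\<close>, vanish at infinity along a
  ray that avoids \<open>S_plus\<close>, and so do the second kind functions. Both satisfy the recurrence up to
  a constant; by induction their difference is constant on the ray, hence zero, and the two
  constants agree.
\<close>

lemma cm_integral_Q_poly:
  assumes a: "\<And>m. \<bar>a m\<bar> \<le> A" and N: "strict_mono N"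
    and \<nu>: "is_complex_measure \<nu>" and K: "compact (cm_support \<nu>)"
    and S: "cm_support \<nu> \<subseteq> S_plus p" and l: "1 \<le> l"
    and lim: "\<And>z. z \<notin> S_plus p \<Longrightarrow>
      (\<lambda>j. poly (Q_assoc a p l ((p + 1) * N j)) z / poly (Q_poly a p ((p + 1) * N j)) z)
        \<longlonglongrightarrow> cm_integral \<nu> (\<lambda>t. 1 / (z - t))"
  shows "cm_integral \<nu> (poly (Q_poly a p n)) = (if Suc n = l then 1 else 0)"
proof -
  obtain \<omega> where \<omega>: "cmod \<omega> = 1" "\<And>r. 0 < r \<Longrightarrow> of_real r * \<omega> \<notin> S_plus p"
    using ray_off_S_plus by blast
  define Z where "Z r = complex_of_real r * \<omega>" for r
  define f where "f z = cm_integral \<nu> (\<lambda>t. 1 / (z - t))" for z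
  define R where "R n z = f z * poly (Q_poly a p n) z - 1 * poly (Q_assoc a p l n) z" for n z
  define T where "T n z = 1 * second_kind a p \<nu> n z - 1 * R n z" for n z
  have Z: "Z r \<notin> S_plus p" "cmod (Z r) = r" if "0 < r" for r
    using \<omega> that by (auto simp: Z_def norm_mult)
  have A0: "0 \<le> A"
    using a[of 0] by linarith
  \<comment> \<open>The bound on the remainders is free of the approximation index, hence survives
    the limit.\<close>
  have R_bound: "cmod (R n z) \<le> 1 / (cmod z - 1 - A)"
    if z: "z \<notin> S_plus p" "1 + A < cmod z" for n z
  proof -
    have "(\<lambda>j. cmod (poly (Q_poly a p n) z
          * (poly (Q_assoc a p l ((p + 1) * N j)) z / poly (Q_poly a p ((p + 1) * N j)) z)
          - poly (Q_assoc a p l n) z))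
        \<longlonglongrightarrow> cmod (poly (Q_poly a p n) z * f z - poly (Q_assoc a p l n) z)"
      unfolding f_def by (intro tendsto_intros lim z(1))
    moreover have "\<forall>\<^sub>F j in sequentially. n < (p + 1) * N j"
    proof (rule eventually_sequentiallyI[of "Suc n"])
      fix j assume "Suc n \<le> j"
      then show "n < (p + 1) * N j"
        using seq_suble[OF N, of j] by (simp add: trans_less_add1)
    qed
    then have "\<forall>\<^sub>F j in sequentially. cmod (poly (Q_poly a p n) z
          * (poly (Q_assoc a p l ((p + 1) * N j)) z / poly (Q_poly a p ((p + 1) * N j)) z)
          - poly (Q_assoc a p l n) z) \<le> 1 / (cmod z - 1 - A)"
      by eventually_elim (rule Pade_remainder_bound[OF a z(2)])
    ultimately have "cmod (poly (Q_poly a p n) z * f z - poly (Q_assoc a p l n) z)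
        \<le> 1 / (cmod z - 1 - A)"
      by (rule tendsto_upperbound) simp
    then show ?thesis
      by (simp add: R_def mult.commute)
  qed
  have T_lim: "((\<lambda>r. T n (Z r)) \<longlongrightarrow> 0) at_top" for n
  proof -
    obtain C \<rho> where C: "\<And>z. \<rho> < cmod z \<Longrightarrow> cmod (second_kind a p \<nu> n z) \<le> C / (cmod z - \<rho>)"
      using second_kind_bound[OF \<nu> K] by blast
    have lim0: "((\<lambda>r. c / (r - s)) \<longlongrightarrow> 0) at_top" for c s :: real
      using filterlim_tendsto_add_at_top[OF tendsto_const[of "- s"] filterlim_ident]
      by (intro tendsto_divide_0[OF tendsto_const] filterlim_at_top_imp_at_infinity) simp
    have "((\<lambda>r. C / (r - \<rho>) + 1 / (r - 1 - A)) \<longlongrightarrow> 0) at_top"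
      using tendsto_add[OF lim0[of C \<rho>] lim0[of 1 "1 + A"]] by (simp add: diff_diff_eq)
    moreover have "\<forall>\<^sub>F r in at_top. cmod (T n (Z r)) \<le> C / (r - \<rho>) + 1 / (r - 1 - A)"
      using eventually_gt_at_top[of \<rho>] eventually_gt_at_top[of "1 + A"]
    proof eventually_elim
      fix r assume r: "\<rho> < r" "1 + A < r"
      then have "cmod (second_kind a p \<nu> n (Z r)) \<le> C / (r - \<rho>)" "cmod (R n (Z r)) \<le> 1 / (r - 1 - A)"
        using C[of "Z r"] R_bound[of "Z r" n] Z[of r] A0 by auto
      then show "cmod (T n (Z r)) \<le> C / (r - \<rho>) + 1 / (r - 1 - A)"
        unfolding T_def using norm_triangle_ineq4[of "second_kind a p \<nu> n (Z r)" "R n (Z r)"] by simp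
    qed
    ultimately show ?thesis
      by (intro Lim_null_comparison[of "\<lambda>r. T n (Z r)" "\<lambda>r. C / (r - \<rho>) + 1 / (r - 1 - A)"]) auto
  qed
  \<comment> \<open>The error in the claimed value is also the defect of T at i, the same at every
    point of the ray.\<close>
  define m where "m i = cm_integral \<nu> (poly (Q_poly a p i)) - (if Suc i = l then 1 else 0)" for i
  have defect: "recurrence_defect a p (Z r) (\<lambda>i. T i (Z r)) i = m i" if "0 < r" for r i
  proof -
    have "Z r \<notin> cm_support \<nu>"
      using S Z[OF that] by auto
    note sk = recurrence_defect_second_kind[OF \<nu> K this]
    show ?thesis
      unfolding T_def R_def recurrence_defect_linear recurrence_defect_Q_poly
        recurrence_defect_Q_assoc sk m_def by simp
  qed
  have step: "m i = 0 \<and> (\<forall>r>0. T (Suc i) (Z r) = 0)"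
    if "\<And>j r. j \<le> i \<Longrightarrow> 0 < r \<Longrightarrow> T j (Z r) = 0" for i
  proof -
    have const: "T (Suc i) (Z r) = - m i" if "0 < r" for r
      using defect[OF that, of i] \<open>\<And>j r. j \<le> i \<Longrightarrow> 0 < r \<Longrightarrow> T j (Z r) = 0\<close> that
      by (auto simp: recurrence_defect_def minus_equation_iff split: if_splits)
    have "((\<lambda>r. T (Suc i) (Z r)) \<longlongrightarrow> - m i) at_top"
      by (intro tendsto_eventually eventually_mono[OF eventually_gt_at_top[of 0]] const)
    from tendsto_unique[OF _ this T_lim] have "m i = 0"
      by simp
    with const show ?thesis
      by simp
  qed
  have T0: "T i (Z r) = 0" if "0 < r" for i r
    using that
  proof (induction i arbitrary: r rule: less_induct)
    case (less i)
    show ?case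
    proof (cases i)
      case 0
      \<comment> \<open>Since Q_0 = 1 and Q_{0,l} = 0, both functions compared by T_0 are the Cauchy
        transform of the measure.\<close>
      have "Q_assoc a p l 0 = 0"
        using l by simp
      then show ?thesis
        by (simp only: 0 T_def R_def) (simp add: second_kind_def f_def Q_poly_def)
    next
      case (Suc j)
      then show ?thesis
        using step[of j] less by auto
    qed
  qed
  show ?thesis
    using step[of n] T0 by (simp add: m_def)
qed

section \<open>Determinant identities\<close>

text \<open>Moving row \<open>m\<close> above the \<open>m\<close> rows already reversed costs
  \<open>m\<close> transpositions, and 0 + ... + (m - 1) is the binomial coefficient.\<close>

lemma det_reverse_initial_rows:
  assumes "M \<in> carrier_mat n n" "m \<le> n"
  shows "det (mat n n (\<lambda>(i, j). M $$ (if i < m then m - 1 - i else i, j)))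
    = (-1) ^ (m choose 2) * det M"
  using assms(2)
proof (induction m)
  case 0
  have "mat n n (\<lambda>(i, j). M $$ (i, j)) = M"
    using assms(1) by (intro eq_matI) auto
  then show ?case
    by (simp add: numeral_2_eq_2)
next
  case (Suc m)
  let ?R = "\<lambda>m. mat n n (\<lambda>(i, j). M $$ (if i < m then m - 1 - i else i, j))"
  have "det (?R m) = (-1) ^ m * det (mat n n (\<lambda>(i, j). ?R m $$
      (if i < 1 then i + m else if i < m + 1 then i - 1 else i, j)))"
    using det_swap_initial_rows[of "?R m" n m 1] Suc.prems by simp
  also have "mat n n (\<lambda>(i, j). ?R m $$
      (if i < 1 then i + m else if i < m + 1 then i - 1 else i, j)) = ?R (Suc m)"
    (is "?L = _")
  proof (rule eq_matI)
    fix i j assume "i < dim_row (?R (Suc m))" "j < dim_col (?R (Suc m))"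
    then show "?L $$ (i, j) = ?R (Suc m) $$ (i, j)"
      using Suc.prems by (cases i) auto
  qed auto
  finally have eq: "det (?R m) = (-1) ^ m * det (?R (Suc m))" .
  have "det (?R (Suc m)) = (-1) ^ m * det (?R m)"
    unfolding eq by (simp only: mult.assoc[symmetric] minus_one_mult_self mult_1_left)
  moreover have "Suc m choose 2 = m + (m choose 2)"
    by (simp add: numeral_2_eq_2)
  moreover have "det (?R m) = (-1) ^ (m choose 2) * det M"
    using Suc by simp
  ultimately show ?case
    by (simp only: power_add mult.assoc)
qed

lemma pick_atLeastLessThan:
  assumes "i < n - k"
  shows "pick {k..<n} i = k + i"
proof -
  have "{a \<in> {k..<n}. a < k + i} = {k..<k + i}"
    using assms by auto
  then show ?thesis
    using pick_card_in_set[of "k + i" "{k..<n}"] assms by simp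
qed

lemma pick_lessThan: "i < n \<Longrightarrow> pick {..<n} i = i"
  using pick_atLeastLessThan[of i n 0] by (simp add: atLeast0LessThan)

text \<open>The selected entry (i, j) is entry (i + k, j) of H - x, split into its three bands to
  match the corner block below. For \<open>n = k\<close> the determinant has size 0 and equals
  1.\<close>

lemma P_eig_eq_det:
  assumes "k \<le> n"
  shows "P_eig a p k n x = det (mat (n - k) (n - k) (\<lambda>(i, j).
    (if j = i + k + 1 then 1 else 0) + (if j = i + k then - x else 0)
      + (if i + k = j + p then of_real (a j) else 0)))" (is "_ = det ?M")
proof (cases "n = k")
  case True
  then show ?thesis
    by (simp add: P_eig_def)
next
  case False
  have "{i. i < n \<and> i \<in> {k..<n}} = {k..<n}" "{j. j < n \<and> j \<in> {..<n - k}} = {..<n - k}"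
    by auto
  then have cards: "card {i. i < n \<and> i \<in> {k..<n}} = n - k" "card {j. j < n \<and> j \<in> {..<n - k}} = n - k"
    by simp_all
  have "submatrix (H_mat a p n - x \<cdot>\<^sub>m 1\<^sub>m n) {k..<n} {..<n - k} = ?M"
  proof -
    have dims: "dim_row (H_mat a p n - x \<cdot>\<^sub>m 1\<^sub>m n) = n" "dim_col (H_mat a p n - x \<cdot>\<^sub>m 1\<^sub>m n) = n"
      by auto
    show ?thesis
      unfolding submatrix_def dims cards
      by (rule eq_matI) (auto simp: H_mat_def pick_atLeastLessThan pick_lessThan)
  qed
  with False assms show ?thesis
    by (simp add: P_eig_def)
qed

text \<open>
  Multiplying \<open>W\<close>, the block matrix with the solutions \<open>u 0, \<dots>, u k\<close> as its first columns, by the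
  unimodular matrix \<open>A\<close> of the recurrence makes all entries below the diagonal vanish in the first
  \<open>k + 1\<close> columns and leaves the submatrix of \<open>H - x\<close> in the lower right corner.
\<close>

lemma det_recurrence_solutions:
  assumes "k \<le> n" and u0: "u 0 0 = 1" "\<And>i. recurrence_defect a p x (u 0) i = 0"
    and uj: "\<And>i j. j \<in> {1..k} \<Longrightarrow> j \<le> i \<Longrightarrow> recurrence_defect a p x (u j) i = 0"
  shows "det (mat (k + 1) (k + 1) (\<lambda>(i, j). u j (n - i))) =
    (-1) ^ (n * (k + 1) - ((k + 1) choose 2))
      * ((-1) ^ k * (\<Prod>j\<in>{1..k}. recurrence_defect a p x (u j) (j - 1))) * P_eig a p k n x"
proof -
  define m where "m = n - k"
  have n: "n = m + k"
    using \<open>k \<le> n\<close> by (simp add: m_def)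
  \<comment> \<open>Row 0 reads off the initial value and row i \<ge> 1 the negated defect at i - 1,
    so that row i + 1 is row i of H - x.\<close>
  define e where "e i j = (if j = i then 1 else 0) + (if Suc j = i then - x else 0)
    + (if i = Suc (j + p) then complex_of_real (a j) else 0)" for i j
  define A where "A = mat (n + 1) (n + 1) (\<lambda>(i, j). e i j)"
  \<comment> \<open>The last m columns are unit vectors, which copy the first m columns of
    \<open>A\<close> into the product.\<close>
  define W where "W = mat (n + 1) (n + 1)
    (\<lambda>(i, j). if j \<le> k then u j i else if j = i + k + 1 then 1 else 0)"
  define V where "V = mat (k + 1) (k + 1) (\<lambda>(i, j). u j (i + m))"
  define U where "U = mat (k + 1) (k + 1)
    (\<lambda>(i, j). if i = 0 then u j 0 else - recurrence_defect a p x (u j) (i - 1))"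
  define D where "D = mat m m (\<lambda>(i, j). e (i + k + 1) j)"

  have A: "A \<in> carrier_mat (n + 1) (n + 1)" and W: "W \<in> carrier_mat (n + 1) (n + 1)"
    by (auto simp: A_def W_def)
  have "det A = prod_list (diag_mat A)"
    by (rule det_lower_triangular[OF _ A]) (auto simp: A_def e_def)
  also have "\<dots> = 1"
    by (auto simp: prod_list_diag_prod A_def e_def intro!: prod.neutral)
  finally have det_A: "det A = 1" .

  \<comment> \<open>Moving the last k + 1 rows to the top leaves a zero block above an identity
    block.\<close>
  have "det W = (-1) ^ (m * (k + 1)) * det (mat (n + 1) (n + 1) (\<lambda>(i, j). W $$
      (if i < k + 1 then i + m else if i < m + (k + 1) then i - (k + 1) else i, j)))"
    by (rule det_swap_initial_rows[OF W]) (simp add: n)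
  also have "mat (n + 1) (n + 1) (\<lambda>(i, j). W $$
      (if i < k + 1 then i + m else if i < m + (k + 1) then i - (k + 1) else i, j))
    = four_block_mat V (0\<^sub>m (k + 1) m) (mat m (k + 1) (\<lambda>(i, j). u j i)) (1\<^sub>m m)"
    by (rule eq_matI) (auto simp: W_def V_def n)
  also have "det \<dots> = det V * det (1\<^sub>m m)"
    by (rule det_four_block_mat_upper_right_zero) (auto simp: V_def)
  finally have det_W: "det W = (-1) ^ (m * (k + 1)) * det V"
    by simp

  have e_sum: "(\<Sum>s = 0..<n + 1. e i s * v s)
      = (if i = 0 then v 0 else - recurrence_defect a p x v (i - 1))" if "i \<le> n" for i v
  proof -
    have 1: "(\<Sum>s = 0..<n + 1. (if s = i then 1 else 0) * v s) = v i"
      using that by (simp add: if_distrib[of "\<lambda>c. c * _"] cong: if_cong)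
    have "(\<Sum>s = 0..<n + 1. (if Suc s = i then - x else 0) * v s)
        = (\<Sum>s = 0..<n + 1. if s = i - 1 then (if i = 0 then 0 else - x * v s) else 0)"
      by (rule sum.cong) auto
    also have "\<dots> = (if i = 0 then 0 else - x * v (i - 1))"
      using that by (cases i) auto
    finally have 2: "(\<Sum>s = 0..<n + 1. (if Suc s = i then - x else 0) * v s)
        = (if i = 0 then 0 else - x * v (i - 1))" .
    have "(\<Sum>s = 0..<n + 1. (if i = Suc (s + p) then complex_of_real (a s) else 0) * v s)
        = (\<Sum>s = 0..<n + 1. if s = i - 1 - p then (if Suc p \<le> i then of_real (a s) * v s else 0) else 0)"
      by (rule sum.cong) auto
    also have "\<dots> = (if Suc p \<le> i then of_real (a (i - 1 - p)) * v (i - 1 - p) else 0)"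
      using that by (cases "Suc p \<le> i") auto
    finally have 3: "(\<Sum>s = 0..<n + 1. (if i = Suc (s + p) then complex_of_real (a s) else 0) * v s)
        = (if Suc p \<le> i then of_real (a (i - 1 - p)) * v (i - 1 - p) else 0)" .
    show ?thesis
      unfolding e_def distrib_right sum.distrib 1 2 3
      by (cases i) (auto simp: recurrence_defect_def)
  qed
  have "A * W = four_block_mat U (mat (k + 1) m (\<lambda>(i, j). e i j)) (0\<^sub>m m (k + 1)) D"
    (is "_ = ?B")
  proof (rule eq_matI)
    fix i j assume "i < dim_row ?B" "j < dim_col ?B"
    then have ij: "i < n + 1" "j < n + 1"
      by (auto simp: U_def D_def n)
    have "(A * W) $$ (i, j) = (\<Sum>s = 0..<n + 1. e i s * W $$ (s, j))"
      using ij A W by (simp add: scalar_prod_def A_def)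
    also have "\<dots> = ?B $$ (i, j)"
    proof (cases "j \<le> k")
      case True
      have "(\<Sum>s = 0..<n + 1. e i s * W $$ (s, j)) = (\<Sum>s = 0..<n + 1. e i s * u j s)"
        using True ij by (intro sum.cong) (auto simp: W_def)
      also have "\<dots> = (if i = 0 then u j 0 else - recurrence_defect a p x (u j) (i - 1))"
        using ij by (intro e_sum) simp
      also have "\<dots> = ?B $$ (i, j)"
        using ij True u0(2) uj[of j "i - 1"] by (cases "j = 0") (auto simp: U_def D_def n)
      finally show ?thesis .
    next
      case False
      have "(\<Sum>s = 0..<n + 1. e i s * W $$ (s, j))
          = (\<Sum>s = 0..<n + 1. if s = j - (k + 1) then e i s else 0)"
        using False ij by (intro sum.cong) (auto simp: W_def)
      also have "\<dots> = e i (j - (k + 1))"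
        using ij by (subst sum.delta) auto
      also have "\<dots> = ?B $$ (i, j)"
        using ij False by (auto simp: U_def D_def n)
      finally show ?thesis .
    qed
    finally show "(A * W) $$ (i, j) = ?B $$ (i, j)" .
  qed (auto simp: A_def W_def U_def D_def n)
  then have "det (A * W) = det U * det D"
    by (simp only:) (rule det_four_block_mat_lower_left_zero, auto simp: U_def D_def)
  then have UD: "det U * det D = (-1) ^ (m * (k + 1)) * det V"
    using det_mult[OF A W] det_A det_W by simp

  \<comment> \<open>Solution j has no defect from index j on, so below the diagonal of
    \<open>U\<close> all entries vanish; the diagonal carries the defects at j - 1.\<close>
  have "recurrence_defect a p x (u j) (i - 1) = 0" if "j < i" "i \<le> k" for i j
    using that u0(2) uj[of j "i - 1"] by (cases "j = 0") auto
  then have "det U = prod_list (diag_mat U)"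
    by (intro det_upper_triangular[of _ "k + 1"]) (auto simp: U_def upper_triangular_def)
  also have "\<dots> = (\<Prod>i = 0..<Suc k. if i = 0 then 1 else - recurrence_defect a p x (u i) (i - 1))"
    unfolding prod_list_diag_prod using u0(1) by (intro prod.cong) (auto simp: U_def)
  also have "\<dots> = (\<Prod>i\<in>{1..k}. - recurrence_defect a p x (u i) (i - 1))"
    by (rule prod.mono_neutral_cong_right) auto
  also have "\<dots> = (-1) ^ k * (\<Prod>i\<in>{1..k}. recurrence_defect a p x (u i) (i - 1))"
    by (simp add: prod_uminus)
  finally have det_U: "det U = \<dots>" .

  have "D = mat (n - k) (n - k) (\<lambda>(i, j).
    (if j = i + k + 1 then 1 else 0) + (if j = i + k then - x else 0)
      + (if i + k = j + p then of_real (a j) else 0))"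
    unfolding D_def m_def by (rule eq_matI) (auto simp: e_def)
  then have det_D: "det D = P_eig a p k n x"
    by (simp only: P_eig_eq_det[OF \<open>k \<le> n\<close>])

  \<comment> \<open>The minor lists indices downwards from n, while \<open>V\<close> lists them
    upwards from m.\<close>
  have "mat (k + 1) (k + 1) (\<lambda>(i, j). u j (n - i))
      = mat (k + 1) (k + 1) (\<lambda>(i, j). V $$ (if i < k + 1 then k + 1 - 1 - i else i, j))"
    by (rule eq_matI) (auto simp: V_def n add.commute)
  then have det_B: "det (mat (k + 1) (k + 1) (\<lambda>(i, j). u j (n - i)))
      = (-1) ^ ((k + 1) choose 2) * det V"
    using det_reverse_initial_rows[of V "k + 1" "k + 1"] V_def by (simp only: mat_carrier order.refl)

  \<comment> \<open>Twice the binomial is k (k + 1), so subtracting it once from n (k + 1) leaves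
    the exponents of the reversal and of the block swap.\<close>
  have "2 * ((k + 1) choose 2) = k * (k + 1)"
    using Suc_times_binomial_eq[of k 1] by (simp add: numeral_2_eq_2)
  moreover have "n * (k + 1) = m * (k + 1) + k * (k + 1)"
    by (simp only: n distrib_right)
  ultimately have "n * (k + 1) - ((k + 1) choose 2) = ((k + 1) choose 2) + m * (k + 1)"
    by linarith
  then have sign: "(-1) ^ (n * (k + 1) - ((k + 1) choose 2))
      = (-1) ^ ((k + 1) choose 2) * (-1 :: complex) ^ (m * (k + 1))"
    by (simp only: power_add)
  have "det V = (-1) ^ (m * (k + 1)) * ((-1) ^ (m * (k + 1)) * det V)"
    by (simp only: mult.assoc[symmetric] minus_one_mult_self mult_1_left)
  also have "\<dots> = (-1) ^ (m * (k + 1)) * (det U * det D)"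
    by (simp only: UD)
  finally show ?thesis
    unfolding det_B sign det_U det_D by (simp only: mult.assoc)
qed

theorem proposition2p6:
  fixes p :: nat and a :: "nat \<Rightarrow> real"
    and N :: "nat \<Rightarrow> nat" and \<nu> :: "nat \<Rightarrow> complex_measure"
    and k n :: nat and x :: complex
  assumes "p \<ge> 1"
    and "\<And>m. a m > 0"
    and "bounded (range a)"
    and "strict_mono N" and "\<And>j. N j > 0"
    and "\<And>l. l \<in> {1..p} \<Longrightarrow> is_complex_measure (\<nu> l)"
    and "\<And>l. l \<in> {1..p} \<Longrightarrow> compact (cm_support (\<nu> l))"
    and "\<And>l. l \<in> {1..p} \<Longrightarrow> cm_support (\<nu> l) \<subseteq> S_plus p"
    and "\<And>l K. l \<in> {1..p} \<Longrightarrow> compact K \<Longrightarrow> K \<subseteq> - S_plus p \<Longrightarrow>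
           uniform_limit K
             (\<lambda>j z. poly (Q_assoc a p l ((p + 1) * N j)) z / poly (Q_poly a p ((p + 1) * N j)) z)
             (\<lambda>z. cm_integral (\<nu> l) (\<lambda>t. 1 / (z - t)))
             sequentially"
    and "k \<le> p" and "k \<le> n"
    and "\<And>j. j \<in> {1..k} \<Longrightarrow> x \<notin> cm_support (\<nu> j)"
  shows "RH_minor a p \<nu> k n x =
    (-1) ^ (n * (k + 1) - ((k + 1) choose 2)) * c_const a p \<nu> k * P_eig a p k n x"
proof -
  \<comment> \<open>Column 0 is the polynomial solution, column j the j-th second kind
    function.\<close>
  define u where "u = (\<lambda>j i. if j = 0 then poly (Q_poly a p i) x else second_kind a p (\<nu> j) i x)"
  obtain A where A: "\<And>m. \<bar>a m\<bar> \<le> A"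
    using assms(3) by (auto simp: bounded_iff)
  have sk: "recurrence_defect a p x (u j) i = cm_integral (\<nu> j) (poly (Q_poly a p i))"
    if "j \<in> {1..k}" for i j
  proof -
    have "j \<in> {1..p}" "j \<noteq> 0"
      using that assms(10) by auto
    then show ?thesis
      using recurrence_defect_second_kind[OF assms(6,7) assms(12)[OF that]] by (simp add: u_def)
  qed
  have orth: "cm_integral (\<nu> j) (poly (Q_poly a p i)) = 0" if j: "j \<in> {1..k}" "j \<le> i" for i j
  proof -
    have jp: "j \<in> {1..p}"
      using j assms(10) by auto
    have "cm_integral (\<nu> j) (poly (Q_poly a p i)) = (if Suc i = j then 1 else 0)"
    proof (rule cm_integral_Q_poly[OF A assms(4) assms(6)[OF jp] assms(7)[OF jp] assms(8)[OF jp]])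
      \<comment> \<open>Locally uniform convergence enters only through the singletons {z}.\<close>
      fix z assume "z \<notin> S_plus p"
      then show "(\<lambda>i. poly (Q_assoc a p j ((p + 1) * N i)) z / poly (Q_poly a p ((p + 1) * N i)) z)
          \<longlonglongrightarrow> cm_integral (\<nu> j) (\<lambda>t. 1 / (z - t))"
        by (intro tendsto_uniform_limitI[OF assms(9)[OF jp, of "{z}"]]) auto
    qed (use j in simp)
    with j show ?thesis
      by simp
  qed
  have "RH_minor a p \<nu> k n x = det (mat (k + 1) (k + 1) (\<lambda>(i, j). u j (n - i)))"
    by (simp add: RH_minor_def u_def)
  also have "\<dots> = (-1) ^ (n * (k + 1) - ((k + 1) choose 2))
      * ((-1) ^ k * (\<Prod>j\<in>{1..k}. recurrence_defect a p x (u j) (j - 1))) * P_eig a p k n x"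
  proof (rule det_recurrence_solutions[OF assms(11)])
    show "u 0 0 = 1"
      by (simp add: u_def Q_poly_def)
    show "recurrence_defect a p x (u 0) i = 0" for i
      using recurrence_defect_Q_poly[of a p x i] by (simp add: u_def)
    show "recurrence_defect a p x (u j) i = 0" if "j \<in> {1..k}" "j \<le> i" for i j
      using sk[OF that(1)] orth[OF that] by simp
  qed
  also have "(-1) ^ k * (\<Prod>j\<in>{1..k}. recurrence_defect a p x (u j) (j - 1)) = c_const a p \<nu> k"
    unfolding c_const_def by (intro arg_cong2[where f = "(*)"] prod.cong sk) auto
  finally show ?thesis .
qed

end
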